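(* Let $S\subset\mathcal H$ be a discrete set of sites in general position. Then the Voronoi cells of $\mathrm{VD}(S)$ are precisely the topological closures of the V-cells with respect to $S$. Moreover, for each nonempty V-cell $V_T$, both $V_T$ and its closure have dimension $n-|T|$.
   Context: Let $n\ge2$, $\mathcal H=\{x\in\mathbb R^n:\sum_ix_i=0\}$, $d_\triangle(a,b)=\sum_i(b_i-a_i)+n\max_i(a_i-b_i)$. For a nonempty discrete $S\subset\mathcal H$ and $a\in S$, $\mathrm{VR}_S(a)=\{x\in\mathcal H:d_\triangle(x,a)\le d_\triangle(x,b)\ \forall b\in S\}$; Voronoi cells are the nonempty intersections of nonempty families of Voronoi regions, and $\mathrm{VD}(S)$ is the poset of these. $S$ is in general position if distinct $a,b\in S$ satisfy $a_i\ne b_i$ for all $i$. Define $D_S(x)=\{a\in S:d_\triangle(x,a)=\min_{b\in S}d_\triangle(x,b)\}$ for $x\in\mathcal H$; for $T\subseteq S$ let $V_T=\{x\in\mathcal H:D_S(x)=T\}$. The nonempty sets $V_T$ are the V-cells (the equivalence classes of $x\equiv y\iff D_S(x)=D_S(y)$). Dimension is meant as that of an ordinary polyhedral complex (tropical polyhedra are ordinary polyhedral complexes). *)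

theory Defs
  imports "HOL-Analysis.Analysis"
begin

definition sum_zero_space :: "(real ^ 'n) set" where
  "sum_zero_space = {x. (\<Sum>i\<in>UNIV. x $ i) = 0}"

definition d_tri :: "real ^ 'n \<Rightarrow> real ^ 'n \<Rightarrow> real" where
  "d_tri a b = (\<Sum>i\<in>UNIV. b $ i - a $ i) + real CARD('n) * Max (range (\<lambda>i. a $ i - b $ i))"

text \<open>A discrete set of sites is one without accumulation points in the ambient space,
  so that it may be infinite but meets every bounded set in a finite set.
  The predicate \<^const>\<open>discrete\<close> alone, which only asks every point of the set to be isolated, is
  too weak: for a set of sites accumulating outside of itself the minimum of the distances
  from a point to the sites need not exist.\<close>

definition discrete_sites :: "(real ^ 'n) set \<Rightarrow> bool" where
  "discrete_sites S \<longleftrightarrow> (\<forall>x. \<not> x islimpt S)"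

lemma discrete_sites_iff: "discrete_sites S \<longleftrightarrow> discrete S \<and> closed S"
  unfolding discrete_sites_def discrete_def closed_limpt isolated_in_islimpt_iff by blast

definition general_position :: "(real ^ 'n) set \<Rightarrow> bool" where
  "general_position S \<longleftrightarrow> (\<forall>a\<in>S. \<forall>b\<in>S. a \<noteq> b \<longrightarrow> (\<forall>i. a $ i \<noteq> b $ i))"

definition voronoi_region :: "(real ^ 'n) set \<Rightarrow> real ^ 'n \<Rightarrow> (real ^ 'n) set" where
  "voronoi_region S a = {x \<in> sum_zero_space. \<forall>b\<in>S. d_tri x a \<le> d_tri x b}"

definition voronoi_cells :: "(real ^ 'n) set \<Rightarrow> (real ^ 'n) set set" where
  "voronoi_cells S =
     {C. C \<noteq> {} \<and> (\<exists>A. A \<noteq> {} \<and> A \<subseteq> S \<and> C = (\<Inter>a\<in>A. voronoi_region S a))}"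

definition nearest_sites :: "(real ^ 'n) set \<Rightarrow> real ^ 'n \<Rightarrow> (real ^ 'n) set" where
  "nearest_sites S x = {a. is_arg_min (d_tri x) (\<lambda>b. b \<in> S) a}"

definition V_set :: "(real ^ 'n) set \<Rightarrow> (real ^ 'n) set \<Rightarrow> (real ^ 'n) set" where
  "V_set S T = {x \<in> sum_zero_space. nearest_sites S x = T}"

definition V_cells :: "(real ^ 'n) set \<Rightarrow> (real ^ 'n) set set" where
  "V_cells S = {V_set S T | T. T \<subseteq> S \<and> V_set S T \<noteq> {}}"

text \<open>The dimension of a (not necessarily convex or closed) polyhedral set: the largest dimension
  of a polyhedron inside it. The two lemmas at the end show that, for the support of a polyhedral
  complex and more generally for a union of relatively open cells of such a complex,
  it is the maximal dimension of the cells involved, independently of the chosen complex.\<close>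

definition polyhedral_dim :: "'a::euclidean_space set \<Rightarrow> int" where
  "polyhedral_dim X = Max {aff_dim P | P. polyhedron P \<and> P \<subseteq> X}"

lemma finite_polyhedral_dims: "finite {aff_dim P | P. polyhedron P \<and> P \<subseteq> (X :: 'a::euclidean_space set)}"
proof (rule finite_subset)
  show "{aff_dim P | P. polyhedron P \<and> P \<subseteq> X} \<subseteq> {-1..int DIM('a)}"
    using aff_dim_geq aff_dim_le_DIM by auto
qed simp

lemma polyhedral_dim_ge:
  "polyhedron P \<Longrightarrow> P \<subseteq> X \<Longrightarrow> aff_dim P \<le> polyhedral_dim X"
  unfolding polyhedral_dim_def by (rule Max_ge[OF finite_polyhedral_dims]) blast

lemma polyhedral_dim_le:
  assumes "\<And>P. polyhedron P \<Longrightarrow> P \<subseteq> X \<Longrightarrow> aff_dim P \<le> d"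
  shows "polyhedral_dim X \<le> d"
proof -
  have "{aff_dim P | P. polyhedron P \<and> P \<subseteq> X} \<noteq> {}"
    using polyhedron_empty by blast
  then show ?thesis
    unfolding polyhedral_dim_def using finite_polyhedral_dims[of X] assms
    by (subst Max_le_iff) auto
qed

lemma convex_subset_Union_affine:
  fixes K :: "'a::euclidean_space set"
  assumes "finite \<A>" "\<And>A. A \<in> \<A> \<Longrightarrow> affine A" "convex K" "K \<noteq> {}" "K \<subseteq> \<Union>\<A>"
  shows "\<exists>A\<in>\<A>. K \<subseteq> A"
  using assms
proof (induction \<A> rule: finite_induct)
  case empty
  then show ?case by auto
next
  case (insert A \<A>)
  show ?case
  proof (rule ccontr)
    assume neg: "\<not> ?case"
    then obtain x where x: "x \<in> K" "x \<notin> A" by auto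
    have "\<not> K \<subseteq> \<Union>\<A>" using insert neg by auto
    then obtain y where y: "y \<in> K" "y \<notin> \<Union>\<A>" by auto
    have "x \<noteq> y" using insert.prems x y by auto
    have fin: "finite (open_segment x y \<inter> B)" if B: "B \<in> insert A \<A>" for B
    proof -
      have aff: "affine B" using B insert.prems(1) by blast
      have nB: "x \<notin> B \<or> y \<notin> B" using B x y by auto
      have "u = v" if uv: "u \<in> open_segment x y \<inter> B" "v \<in> open_segment x y \<inter> B" for u v
      proof (rule ccontr)
        assume "u \<noteq> v"
        obtain s where s: "u = (1 - s) *\<^sub>R x + s *\<^sub>R y" using uv by (auto simp: in_segment)
        obtain t where t: "v = (1 - t) *\<^sub>R x + t *\<^sub>R y" using uv by (auto simp: in_segment)
        have st: "s \<noteq> t" using s t \<open>u \<noteq> v\<close> by auto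
        have comb: "(1 - c) *\<^sub>R u + c *\<^sub>R v \<in> B" for c
          using aff uv unfolding affine_alt by blast
        have lin: "(1 - c) *\<^sub>R u + c *\<^sub>R v =
            (1 - ((1 - c) * s + c * t)) *\<^sub>R x + ((1 - c) * s + c * t) *\<^sub>R y" for c
          unfolding s t by (simp add: algebra_simps)
        have "(1 - s / (s - t)) * s + s / (s - t) * t = s - s / (s - t) * (s - t)"
          by (simp only: algebra_simps)
        then have e0: "(1 - s / (s - t)) * s + s / (s - t) * t = 0"
          using st by simp
        have "(1 - (s - 1) / (s - t)) * s + (s - 1) / (s - t) * t = s - (s - 1) / (s - t) * (s - t)"
          by (simp only: algebra_simps)
        then have e1: "(1 - (s - 1) / (s - t)) * s + (s - 1) / (s - t) * t = 1"
          using st by simp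
        have "x \<in> B" using comb[of "s / (s - t)"] unfolding lin e0 by simp
        moreover have "y \<in> B" using comb[of "(s - 1) / (s - t)"] unfolding lin e1 by simp
        ultimately show False using nB by blast
      qed
      then have "\<exists>u. open_segment x y \<inter> B \<subseteq> {u}" by blast
      then show ?thesis using finite_subset by blast
    qed
    have "open_segment x y \<subseteq> \<Union>(insert A \<A>)"
      using insert.prems x y by (meson convex_contains_open_segment order_trans)
    then have "open_segment x y = (\<Union>B\<in>insert A \<A>. open_segment x y \<inter> B)" by auto
    then have "finite (open_segment x y)"
      using fin insert.hyps(1) by (metis (no_types, lifting) finite_UN_I finite.insertI)
    then show False using \<open>x \<noteq> y\<close> by simp
  qed
qed

lemma aff_dim_le_locally_finite_cover:
  fixes \<C> :: "'a::euclidean_space set set"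
  assumes lf: "locally_finite_in euclidean \<C>"
    and d: "\<And>P. P \<in> \<C> \<Longrightarrow> aff_dim P \<le> d" and "-1 \<le> d"
    and Q: "convex Q" "Q \<subseteq> \<Union>\<C>"
  shows "aff_dim Q \<le> d"
proof (cases "Q = {}")
  case False
  then obtain x where x: "x \<in> Q" by auto
  obtain U where U: "open U" "x \<in> U" "finite {P \<in> \<C>. P \<inter> U \<noteq> {}}"
    using lf unfolding locally_finite_in_def by auto
  obtain e where e: "e > 0" "ball x e \<subseteq> U" using U openE by blast
  let ?K = "Q \<inter> ball x e"
  have ne: "?K \<noteq> {}" using x e by auto
  have K: "?K \<subseteq> \<Union>((hull) affine ` {P \<in> \<C>. P \<inter> U \<noteq> {}})"
  proof
    fix y assume y: "y \<in> ?K"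
    then obtain P where "P \<in> \<C>" "y \<in> P" using Q by blast
    moreover have "y \<in> U" using y e by auto
    ultimately have "P \<in> {P \<in> \<C>. P \<inter> U \<noteq> {}}" "y \<in> affine hull P"
      by (auto intro: hull_inc)
    then show "y \<in> \<Union>((hull) affine ` {P \<in> \<C>. P \<inter> U \<noteq> {}})" by blast
  qed
  have "\<exists>A\<in>(hull) affine ` {P \<in> \<C>. P \<inter> U \<noteq> {}}. ?K \<subseteq> A"
    by (rule convex_subset_Union_affine) (use U Q ne K in \<open>auto intro: convex_Int\<close>)
  then obtain P where P: "P \<in> \<C>" "?K \<subseteq> affine hull P" by auto
  have "aff_dim Q = aff_dim ?K"
    using aff_dim_convex_Int_open[of Q "ball x e"] Q ne by simp
  also have "\<dots> \<le> aff_dim P" using aff_dim_subset[OF P(2)] by simp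
  finally show ?thesis using d[OF P(1)] by simp
qed (use \<open>-1 \<le> d\<close> in simp)

lemma polyhedral_dim_locally_finite:
  fixes \<C> :: "'a::euclidean_space set set"
  assumes poly: "\<And>P. P \<in> \<C> \<Longrightarrow> polyhedron P" and ne: "\<C> \<noteq> {}"
    and lf: "locally_finite_in euclidean \<C>"
    and X: "(\<Union>P\<in>\<C>. rel_interior P) \<subseteq> X" "X \<subseteq> \<Union>\<C>"
  shows "polyhedral_dim X = Max (aff_dim ` \<C>)"
proof (rule antisym)
  have "aff_dim ` \<C> \<subseteq> {-1..int DIM('a)}"
    using aff_dim_geq aff_dim_le_DIM by auto
  then have fin: "finite (aff_dim ` \<C>)" using finite_subset by blast
  have "-1 \<le> Max (aff_dim ` \<C>)"
    using fin ne aff_dim_geq by (subst Max_ge_iff) auto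
  then have "aff_dim Q \<le> Max (aff_dim ` \<C>)" if "polyhedron Q" "Q \<subseteq> X" for Q
    using aff_dim_le_locally_finite_cover[OF lf Max_ge[OF fin imageI]] polyhedron_imp_convex
      order_trans[OF that(2) X(2)] that(1) by blast
  then show "polyhedral_dim X \<le> Max (aff_dim ` \<C>)" by (rule polyhedral_dim_le)
  have "aff_dim P \<le> polyhedral_dim X" if P: "P \<in> \<C>" for P
  proof (cases "P = {}")
    case True
    then show ?thesis using polyhedral_dim_ge[OF polyhedron_empty, of X] by simp
  next
    case False
    have "convex P" using poly[OF P] by (rule polyhedron_imp_convex)
    then obtain x where x: "x \<in> rel_interior P" using False rel_interior_eq_empty by blast
    obtain T where T: "open T" "rel_interior P = affine hull P \<inter> T"
      using openin_rel_interior[of P] by (auto simp: openin_open)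
    obtain a b where ab: "x \<in> box a b" "cbox a b \<subseteq> T"
      using open_contains_cbox[of T x] T x by (metis Int_iff)
    let ?R = "affine hull P \<inter> cbox a b"
    have "affine hull P \<inter> box a b \<noteq> {}" using ab x T by blast
    then have "aff_dim P = aff_dim (affine hull P \<inter> box a b)"
      using aff_dim_convex_Int_open[of "affine hull P" "box a b"]
      by (simp add: affine_imp_convex open_box)
    also have "\<dots> \<le> aff_dim ?R"
      using box_subset_cbox by (intro aff_dim_subset) blast
    also have "\<dots> \<le> polyhedral_dim X"
    proof (rule polyhedral_dim_ge)
      show "polyhedron ?R"
        by (intro polyhedron_Int affine_imp_polyhedron affine_affine_hull polyhedron_interval)
      show "?R \<subseteq> X" using ab T X(1) P by blast
    qed
    finally show ?thesis .
  qed
  then show "Max (aff_dim ` \<C>) \<le> polyhedral_dim X" using fin ne by simp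
qed

lemma polyhedral_dim_Union:
  fixes \<C> :: "'a::euclidean_space set set"
  assumes "\<And>P. P \<in> \<C> \<Longrightarrow> polyhedron P" "\<C> \<noteq> {}" "locally_finite_in euclidean \<C>"
  shows "polyhedral_dim (\<Union>\<C>) = Max (aff_dim ` \<C>)"
  by (rule polyhedral_dim_locally_finite[OF assms]) (use rel_interior_subset in blast)+

lemma polyhedral_dim_Union_rel_interior:
  fixes \<C> :: "'a::euclidean_space set set"
  assumes "\<And>P. P \<in> \<C> \<Longrightarrow> polyhedron P" "\<C> \<noteq> {}" "locally_finite_in euclidean \<C>"
  shows "polyhedral_dim (\<Union>P\<in>\<C>. rel_interior P) = Max (aff_dim ` \<C>)"
  by (rule polyhedral_dim_locally_finite[OF assms]) (use rel_interior_subset in blast)+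

end

theory Submission
  imports Defs
begin

text \<open>Between points of the sum-zero space the distance from x to a is n times the maximum of the
  x_i - a_i. After subtracting the distance to the nearest sites from all coordinates of x, one gets
  the corner w of an orthant whose interior contains no site and whose boundary contains precisely
  the nearest sites; in general position, different nearest sites touch different facets.
  Raising the coordinates of w on the facets touched by unwanted sites discards these sites and
  keeps the others, so every x at which all sites of A are nearest is a limit of points at which
  precisely those of A are. As for the dimension, fixing one touched facet for each site of T leaves
  n - |T| free coordinates of w: such affine spaces cover the closed cell, and lowering
  the free coordinates slightly stays within the V-cell by discreteness.\<close>

section \<open>Distances as coordinate maxima, and the projection to the sum-zero space\<close>

text \<open>Adding a constant to all coordinates of the first argument leaves \<open>d_tri\<close>
  unchanged but shifts this maximum, so the maximum can be normalised to 0 at points outside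
  \<open>sum_zero_space\<close>.\<close>

definition tmax :: "real ^ 'n \<Rightarrow> real ^ 'n \<Rightarrow> real" where
  "tmax x a = Max (range (\<lambda>i. x $ i - a $ i))"

text \<open>The orthogonal projection onto \<open>sum_zero_space\<close>; its fibres are the lines
  in direction \<open>vec 1\<close>.\<close>

definition proj :: "real ^ 'n \<Rightarrow> real ^ 'n" where
  "proj w = w - vec ((\<Sum>i\<in>UNIV. w $ i) / real CARD('n))"

text \<open>The orthant of all points above w has no site in its interior, and its boundary meets S in T.\<close>

definition corner :: "(real ^ 'n) set \<Rightarrow> (real ^ 'n) set \<Rightarrow> real ^ 'n \<Rightarrow> bool" where
  "corner S T w \<longleftrightarrow> T \<subseteq> S \<and> (\<forall>a\<in>T. tmax w a = 0) \<and> (\<forall>b\<in>S - T. 0 < tmax w b)"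

lemma tmax_le_iff: "tmax w a \<le> c \<longleftrightarrow> (\<forall>i. w $ i - a $ i \<le> c)"
  unfolding tmax_def by (subst Max_le_iff) auto

lemma less_tmax_iff: "c < tmax w a \<longleftrightarrow> (\<exists>i. c < w $ i - a $ i)"
  unfolding tmax_def by (subst Max_gr_iff) auto

lemma le_tmax_iff: "c \<le> tmax w a \<longleftrightarrow> (\<exists>i. c \<le> w $ i - a $ i)"
  unfolding tmax_def by (subst Max_ge_iff) auto

lemma tmax_eq_0_iff: "tmax w a = 0 \<longleftrightarrow> (\<forall>i. w $ i \<le> a $ i) \<and> (\<exists>i. w $ i = a $ i)"
proof -
  have "tmax w a = 0 \<longleftrightarrow> tmax w a \<le> 0 \<and> 0 \<le> tmax w a" by auto
  also have "\<dots> \<longleftrightarrow> (\<forall>i. w $ i \<le> a $ i) \<and> (\<exists>i. a $ i \<le> w $ i)"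
    unfolding tmax_le_iff le_tmax_iff by simp
  also have "\<dots> \<longleftrightarrow> (\<forall>i. w $ i \<le> a $ i) \<and> (\<exists>i. w $ i = a $ i)"
    by (metis antisym order_refl)
  finally show ?thesis .
qed

lemma tmax_diff_vec: "tmax (w - vec c) a = tmax w a - c"
proof -
  have "tmax (w - vec c) a \<le> b \<longleftrightarrow> tmax w a - c \<le> b" for b
  proof -
    have "tmax (w - vec c) a \<le> b \<longleftrightarrow> tmax w a \<le> b + c"
      unfolding tmax_le_iff by (auto simp: algebra_simps)
    then show ?thesis by linarith
  qed
  then show ?thesis by (meson antisym order_refl)
qed

lemma d_tri_eq_tmax:
  fixes x a :: "real ^ 'n"
  assumes "x \<in> sum_zero_space" "a \<in> sum_zero_space"
  shows "d_tri x a = real CARD('n) * tmax x a"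
  using assms unfolding d_tri_def tmax_def sum_zero_space_def by (simp add: sum_subtractf)

lemma proj_in_sum_zero_space: "proj w \<in> sum_zero_space"
  unfolding proj_def sum_zero_space_def by (simp add: sum_subtractf)

lemma proj_eq_self: "x \<in> sum_zero_space \<Longrightarrow> proj x = x"
  unfolding proj_def sum_zero_space_def by (simp add: vec_eq_iff)

lemma proj_diff_vec: "proj (w - vec c) = proj w"
  unfolding proj_def by (simp add: vec_eq_iff sum_subtractf diff_divide_distrib)

lemma linear_proj: "linear proj"
  unfolding proj_def
  by (rule linearI) (simp_all add: vec_eq_iff sum.distrib add_divide_distrib
      sum_distrib_left[symmetric] algebra_simps)

section \<open>Nearest sites and corners\<close>

lemma nearest_sites_iff:
  assumes "S \<subseteq> sum_zero_space" "x \<in> sum_zero_space"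
  shows "a \<in> nearest_sites S x \<longleftrightarrow> a \<in> S \<and> (\<forall>b\<in>S. tmax x a \<le> tmax x b)"
  using assms d_tri_eq_tmax[of x] unfolding nearest_sites_def is_arg_min_def
  by (auto simp: not_less subset_iff)

text \<open>Projecting shifts all values \<open>tmax w b\<close> by the same constant, hence keeps
  the minimisers. At a corner the minimum is 0, attained exactly on \<open>T\<close>; nonemptiness
  of \<open>T\<close> ensures that it is attained.\<close>

lemma nearest_sites_proj_corner:
  assumes "S \<subseteq> sum_zero_space" "corner S T w" "T \<noteq> {}"
  shows "nearest_sites S (proj w) = T"
proof -
  have "a \<in> nearest_sites S (proj w) \<longleftrightarrow> a \<in> S \<and> (\<forall>b\<in>S. tmax w a \<le> tmax w b)" for a
    using nearest_sites_iff[OF assms(1) proj_in_sum_zero_space]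
    unfolding proj_def tmax_diff_vec by simp
  moreover have "a \<in> S \<and> (\<forall>b\<in>S. tmax w a \<le> tmax w b) \<longleftrightarrow> a \<in> T" for a
  proof
    assume a: "a \<in> S \<and> (\<forall>b\<in>S. tmax w a \<le> tmax w b)"
    obtain t where "t \<in> T" using assms by auto
    then have "tmax w a \<le> 0" using a assms(2) unfolding corner_def by force
    then show "a \<in> T" using a assms(2) unfolding corner_def by force
  next
    assume "a \<in> T"
    then show "a \<in> S \<and> (\<forall>b\<in>S. tmax w a \<le> tmax w b)"
      using assms(2) unfolding corner_def by (metis Diff_iff less_imp_le order_refl subsetD)
  qed
  ultimately show ?thesis by blast
qed

text \<open>Subtracting the common minimal value of \<open>tmax x\<close> from all coordinates of
  \<open>x\<close> gives the corner.\<close>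

lemma ex_corner:
  assumes S: "S \<subseteq> sum_zero_space" and x: "x \<in> sum_zero_space" and ne: "nearest_sites S x \<noteq> {}"
  shows "\<exists>w. corner S (nearest_sites S x) w \<and> proj w = x"
proof -
  obtain a where a: "a \<in> nearest_sites S x" using ne by auto
  note iff = nearest_sites_iff[OF S x]
  have "tmax x b = tmax x a" if "b \<in> nearest_sites S x" for b
    using that a iff by (meson antisym)
  moreover have "tmax x a < tmax x b" if "b \<in> S - nearest_sites S x" for b
    using that a iff by (metis Diff_iff leI order_trans)
  ultimately have "corner S (nearest_sites S x) (x - vec (tmax x a))"
    using iff unfolding corner_def tmax_diff_vec by auto
  then show ?thesis using proj_diff_vec[of x] proj_eq_self[OF x] by metis
qed

section \<open>Existence of nearest sites\<close>

text \<open>For vectors of sum zero, lower bounds on all coordinates imply upper bounds, so the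
  sites lie in a compact box, where only finitely many fit without accumulating.\<close>

lemma finite_sites_bounded_below:
  fixes S :: "(real ^ 'n) set"
  assumes "S \<subseteq> sum_zero_space" "discrete_sites S"
  shows "finite {a \<in> S. \<forall>i. l $ i \<le> a $ i}"
proof -
  \<comment> \<open>From \<open>a $ i\<close> being minus the sum of the other coordinates, each at
    least that of \<open>l\<close>.\<close>
  let ?u = "\<chi> i. l $ i - (\<Sum>j\<in>UNIV. l $ j)"
  have "{a \<in> S. \<forall>i. l $ i \<le> a $ i} \<subseteq> cbox l ?u \<inter> S"
  proof
    fix a assume a: "a \<in> {a \<in> S. \<forall>i. l $ i \<le> a $ i}"
    then have sum0: "(\<Sum>j\<in>UNIV. a $ j) = 0" using assms unfolding sum_zero_space_def by auto
    have "a $ i \<le> ?u $ i" for i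
    proof -
      have "(\<Sum>j\<in>UNIV - {i}. l $ j) \<le> (\<Sum>j\<in>UNIV - {i}. a $ j)"
        using a by (intro sum_mono) auto
      then show ?thesis
        using sum0 sum.remove[of UNIV i "\<lambda>j. a $ j"] sum.remove[of UNIV i "\<lambda>j. l $ j"] by simp
    qed
    then show "a \<in> cbox l ?u \<inter> S" using a by (auto simp: mem_box_cart)
  qed
  moreover have "finite (cbox l ?u \<inter> S)"
    using assms(2) unfolding discrete_sites_def
    by (intro finite_not_islimpt_in_compact) auto
  ultimately show ?thesis by (rule finite_subset)
qed

text \<open>The sites no farther from \<open>x\<close> than a fixed site \<open>b\<close> are
  bounded below coordinatewise, so the minimum is taken over a finite set.\<close>

lemma nearest_sites_nonempty:
  assumes "S \<subseteq> sum_zero_space" "discrete_sites S" "S \<noteq> {}" "x \<in> sum_zero_space"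
  shows "nearest_sites S x \<noteq> {}"
proof -
  obtain b where b: "b \<in> S" using assms by auto
  define F where "F = {a \<in> S. tmax x a \<le> tmax x b}"
  have "F = {a \<in> S. \<forall>i. (x - vec (tmax x b)) $ i \<le> a $ i}"
    unfolding F_def tmax_le_iff[of x _ "tmax x b"] by (auto simp: algebra_simps)
  then have fin: "finite F" using finite_sites_bounded_below[OF assms(1,2)] by metis
  have ne: "F \<noteq> {}" using b unfolding F_def by blast
  obtain a where "is_arg_min (tmax x) (\<lambda>a. a \<in> F) a"
    using ex_is_arg_min_if_finite[OF fin ne, of "tmax x"] ..
  then have a: "a \<in> F" "\<And>c. c \<in> F \<Longrightarrow> tmax x a \<le> tmax x c"
    unfolding is_arg_min_def by (auto simp: not_less)
  have "tmax x a \<le> tmax x c" if "c \<in> S" for c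
    using a that unfolding F_def by fastforce
  then have "a \<in> nearest_sites S x" using a(1) nearest_sites_iff[OF assms(1,4)] unfolding F_def by blast
  then show ?thesis by blast
qed

lemma finite_positive_gap:
  fixes A :: "real set"
  assumes "finite A"
  shows "\<exists>e>0. \<forall>r\<in>A. 0 < r \<longrightarrow> e < r"
proof -
  \<comment> \<open>The 1 keeps the set nonempty when \<open>A\<close> has no positive
    element.\<close>
  let ?B = "insert 1 {r \<in> A. 0 < r}"
  have fin: "finite ?B" using assms by auto
  have pos: "0 < Min ?B" using fin by (subst Min_gr_iff) auto
  have "Min ?B / 2 < r" if "r \<in> A" "0 < r" for r
  proof -
    have "Min ?B \<le> r" using fin that by (intro Min_le) auto
    then show ?thesis using pos by linarith
  qed
  then show ?thesis using pos by (intro exI[of _ "Min ?B / 2"]) auto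
qed

section \<open>Perturbing a corner in general position\<close>

text \<open>Two sites touching the same facet would share a coordinate with \<open>w\<close>, hence
  with each other.\<close>

lemma corner_contacts:
  assumes gp: "general_position S" and T: "T \<subseteq> S" and t0: "\<And>a. a \<in> T \<Longrightarrow> tmax w a = 0"
  shows "\<exists>\<sigma>. inj_on \<sigma> T \<and> (\<forall>a\<in>T. w $ \<sigma> a = a $ \<sigma> a)"
proof -
  have "\<forall>a\<in>T. \<exists>i. w $ i = a $ i" using t0 tmax_eq_0_iff by blast
  then obtain \<sigma> where \<sigma>: "\<forall>a\<in>T. w $ \<sigma> a = a $ \<sigma> a" by metis
  then have "inj_on \<sigma> T" using gp T unfolding inj_on_def general_position_def by (metis subsetD)
  then show ?thesis using \<sigma> by blast
qed

lemma corner_finite: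
  fixes S :: "(real ^ 'n) set"
  assumes "general_position S" "corner S T w"
  shows "finite T"
proof -
  obtain \<sigma> :: "real ^ 'n \<Rightarrow> 'n" where "inj_on \<sigma> T"
    using corner_contacts[OF assms(1), of T w] assms(2) unfolding corner_def by blast
  then show ?thesis by (rule inj_on_finite) auto
qed

text \<open>Move \<open>w\<close> to \<open>w + e *\<^sub>R v\<close> for small \<open>e\<close>. A
  raised coordinate puts each site of \<open>T - A\<close> outside the orthant, sites already
  outside stay there as no coordinate decreases, and sites of \<open>A\<close> keep their contacts
  since none of them touches a raised facet.\<close>

lemma corner_perturb:
  fixes S :: "(real ^ 'n) set"
  assumes gp: "general_position S" and c: "corner S T w" and A: "A \<subseteq> T"
  shows "w \<in> closure {w'. corner S A w'}"
  unfolding closure_approachable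
proof (intro allI impI)
  fix \<delta> :: real assume \<delta>: "\<delta> > 0"
  \<comment> \<open>Indicator of the facets touched by the unwanted sites.\<close>
  define v :: "real ^ 'n" where "v = (\<chi> i. if \<exists>b\<in>T - A. b $ i = w $ i then 1 else 0)"
  have finA: "finite A" using corner_finite[OF gp c] A finite_subset by blast
  have T: "T \<subseteq> S" and le: "\<And>a i. a \<in> T \<Longrightarrow> w $ i \<le> a $ i"
    and ex: "\<And>a. a \<in> T \<Longrightarrow> \<exists>i. w $ i = a $ i"
    and out: "\<And>b. b \<in> S - T \<Longrightarrow> \<exists>i. 0 < w $ i - b $ i"
    using c unfolding corner_def tmax_eq_0_iff less_tmax_iff by auto
  have "finite ((\<lambda>(a, i). a $ i - w $ i) ` (A \<times> UNIV))" using finA by auto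
  from finite_positive_gap[OF this] obtain g where g: "g > 0"
    "\<And>a i. a \<in> A \<Longrightarrow> w $ i < a $ i \<Longrightarrow> w $ i + g < a $ i" by force
  \<comment> \<open>The bound \<open>g\<close> keeps the sites of \<open>A\<close> in the orthant,
    the other bound makes the move shorter than \<delta>; adding 1 covers the case
    \<open>v = 0\<close>.\<close>
  define e where "e = min g (\<delta> / (norm v + 1))"
  have nv: "norm v + 1 > 0" by (simp add: add_nonneg_pos)
  have e: "e > 0" "e \<le> g" using g(1) \<delta> nv unfolding e_def by simp_all
  have "e \<le> \<delta> / (norm v + 1)" unfolding e_def by simp
  then have e\<delta>: "e * (norm v + 1) \<le> \<delta>" using nv by (simp only: pos_le_divide_eq)
  let ?w = "w + e *\<^sub>R v"
  have v01: "v $ i = 0 \<or> v $ i = 1" for i by (simp add: v_def)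
  have v1: "v $ i = 1 \<longleftrightarrow> (\<exists>b\<in>T - A. b $ i = w $ i)" for i by (simp add: v_def)
  have ge: "w $ i \<le> ?w $ i" for i using v01[of i] e by auto
  have same: "v $ i = 0" if "a \<in> A" "w $ i = a $ i" for a i
  proof (rule ccontr)
    assume "v $ i \<noteq> 0"
    then obtain b where b: "b \<in> T - A" "b $ i = w $ i" using v1 v01 by blast
    then have "a = b" using gp that A T unfolding general_position_def by (metis DiffD1 subsetD)
    then show False using b that by blast
  qed
  have "corner S A ?w"
    unfolding corner_def tmax_eq_0_iff less_tmax_iff
  proof (intro conjI ballI allI)
    show "A \<subseteq> S" using A T by blast
  next
    fix a i assume a: "a \<in> A"
    then have "w $ i = a $ i \<or> w $ i < a $ i" using le A by (meson le_less subsetD)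
    then show "?w $ i \<le> a $ i"
      using same[OF a, of i] g(2)[OF a, of i] v01[of i] e by auto
  next
    fix a assume a: "a \<in> A"
    then obtain i where "w $ i = a $ i" using ex A by blast
    then show "\<exists>i. ?w $ i = a $ i" using same[OF a] by (intro exI[of _ i]) simp
  next
    fix b assume b: "b \<in> S - A"
    show "\<exists>i. 0 < ?w $ i - b $ i"
    proof (cases "b \<in> T")
      case True
      then obtain i where i: "w $ i = b $ i" using ex by blast
      then have "v $ i = 1" using v1 True b by force
      then show ?thesis using i e by (intro exI[of _ i]) simp
    next
      case False
      then obtain i where "0 < w $ i - b $ i" using out b by blast
      then show ?thesis using ge[of i] by (intro exI[of _ i]) linarith
    qed
  qed
  moreover have "dist ?w w < \<delta>"
    using e e\<delta> by (simp add: dist_norm algebra_simps)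
  ultimately show "\<exists>y\<in>{w'. corner S A w'}. dist y w < \<delta>" by blast
qed

text \<open>The perturbed corners are carried to \<open>sum_zero_space\<close> by the continuous map
  \<open>proj\<close>.\<close>

lemma V_set_perturb:
  assumes "S \<subseteq> sum_zero_space" "general_position S" "x \<in> sum_zero_space"
    "A \<subseteq> nearest_sites S x" "A \<noteq> {}"
  shows "x \<in> closure (V_set S A)"
proof -
  obtain w where w: "corner S (nearest_sites S x) w" "proj w = x"
    using ex_corner[OF assms(1,3)] assms(4,5) by blast
  have "w \<in> closure {w'. corner S A w'}" using corner_perturb[OF assms(2) w(1) assms(4)] .
  then have "x \<in> proj ` closure {w'. corner S A w'}" using w by blast
  also have "\<dots> \<subseteq> closure (proj ` {w'. corner S A w'})"
    using linear_proj by (intro closure_bounded_linear_image_subset linear_conv_bounded_linear[THEN iffD1])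
  also have "\<dots> \<subseteq> closure (V_set S A)"
    using nearest_sites_proj_corner[OF assms(1) _ assms(5)] proj_in_sum_zero_space
    unfolding V_set_def by (intro closure_mono) auto
  finally show ?thesis .
qed

section \<open>Voronoi regions and closures of V-cells\<close>

text \<open>Comparing two maxima means that each term of the first is at most some term of the
  second: an intersection of finite unions of closed half-spaces (or trivial conditions).\<close>

lemma closed_voronoi_region:
  fixes S :: "(real ^ 'n) set"
  assumes "S \<subseteq> sum_zero_space" "a \<in> S"
  shows "closed (voronoi_region S a)"
proof -
  have "voronoi_region S a = {x. (\<Sum>i\<in>UNIV. x $ i) = 0} \<inter>
      (\<Inter>b\<in>S. \<Inter>i. \<Union>j. {x. x $ i - a $ i \<le> x $ j - b $ j})"
  proof -
    have "d_tri x a \<le> d_tri x b \<longleftrightarrow> (\<forall>i. \<exists>j. x $ i - a $ i \<le> x $ j - b $ j)"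
      if "x \<in> sum_zero_space" "b \<in> S" for x b
    proof -
      have "d_tri x a \<le> d_tri x b \<longleftrightarrow> tmax x a \<le> tmax x b"
        using assms that by (simp add: d_tri_eq_tmax subset_iff)
      also have "\<dots> \<longleftrightarrow> (\<forall>i. x $ i - a $ i \<le> tmax x b)" by (rule tmax_le_iff)
      also have "\<dots> \<longleftrightarrow> (\<forall>i. \<exists>j. x $ i - a $ i \<le> x $ j - b $ j)" by (simp only: le_tmax_iff)
      finally show ?thesis .
    qed
    then show ?thesis unfolding voronoi_region_def by (auto simp: sum_zero_space_def)
  qed
  also have "closed \<dots>"
  proof (intro closed_Int closed_INT ballI closed_UN)
    show "closed {x :: real ^ 'n. (\<Sum>i\<in>UNIV. x $ i) = 0}"
      by (intro closed_Collect_eq continuous_intros)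
    show "closed {x :: real ^ 'n. x $ i - a $ i \<le> x $ j - b $ j}" for b i j
      by (intro closed_Collect_le continuous_intros)
  qed simp
  finally show ?thesis .
qed

lemma Inter_voronoi_regions:
  assumes "A \<subseteq> S" "A \<noteq> {}"
  shows "(\<Inter>a\<in>A. voronoi_region S a) = {x \<in> sum_zero_space. A \<subseteq> nearest_sites S x}"
  using assms unfolding voronoi_region_def nearest_sites_def is_arg_min_def
  by (auto simp: not_less subset_iff)

text \<open>The right-hand side is an intersection of Voronoi regions, hence closed; density of the
  V-cell in it is \<open>V_set_perturb\<close>. In particular a nonempty intersection of regions
  forces its V-cell to be nonempty.\<close>

lemma closure_V_set:
  assumes "S \<subseteq> sum_zero_space" "general_position S" "A \<subseteq> S" "A \<noteq> {}"
  shows "closure (V_set S A) = {x \<in> sum_zero_space. A \<subseteq> nearest_sites S x}"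
proof
  have "closed {x \<in> sum_zero_space. A \<subseteq> nearest_sites S x}"
    unfolding Inter_voronoi_regions[OF assms(3,4), symmetric]
    using closed_voronoi_region[OF assms(1)] assms(3) by blast
  then show "closure (V_set S A) \<subseteq> {x \<in> sum_zero_space. A \<subseteq> nearest_sites S x}"
    by (rule closure_minimal[rotated]) (auto simp: V_set_def)
  show "{x \<in> sum_zero_space. A \<subseteq> nearest_sites S x} \<subseteq> closure (V_set S A)"
    using V_set_perturb[OF assms(1,2)] assms(4) by blast
qed

section \<open>Affine pieces and the upper bound on the dimension\<close>

lemma affine_fixed_coordinates: "affine {w :: real ^ 'n. \<forall>j\<in>J. w $ j = c $ j}"
proof -
  have "u * r + v * r = r" if "u + v = 1" for u v r :: real
    using that by (metis distrib_right mult_1)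
  then show ?thesis unfolding affine_def by auto
qed

lemma affine_proj_image:
  assumes "affine B"
  shows "affine (proj ` B)"
proof -
  have "proj ` (affine hull B) = affine hull (proj ` B)"
    using linear_proj by (intro affine_hull_linear_image linear_conv_bounded_linear[THEN iffD1])
  then show ?thesis using assms affine_affine_hull[of "proj ` B"] by (simp add: affine_hull_eq[THEN iffD2])
qed

text \<open>The set is the translate by \<open>c\<close> of the subspace spanned by the axes outside
  \<open>J\<close>.\<close>

lemma aff_dim_fixed_coordinates:
  fixes c :: "real ^ 'n"
  shows "aff_dim {w. \<forall>j\<in>J. w $ j = c $ j} = int CARD('n) - int (card J)"
proof -
  let ?L = "{w :: real ^ 'n. \<forall>i\<in>Basis. i \<notin> (\<lambda>i. axis i 1) ` (- J) \<longrightarrow> w \<bullet> i = 0}"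
  have L: "?L = {w. \<forall>j\<in>J. w $ j = 0}"
    by (auto simp: Basis_vec_def axis_eq_axis inner_axis)
  have "{w. \<forall>j\<in>J. w $ j = c $ j} = (+) c ` ?L"
  proof -
    have "w \<in> (+) c ` ?L" if "\<forall>j\<in>J. w $ j = c $ j" for w
      using that unfolding L by (intro image_eqI[of _ _ "w - c"]) auto
    then show ?thesis unfolding L by auto
  qed
  then have "aff_dim {w. \<forall>j\<in>J. w $ j = c $ j} = aff_dim ?L"
    by (simp add: aff_dim_translation_eq)
  also have "\<dots> = int (dim ?L)"
    unfolding L by (intro aff_dim_subspace) (auto simp: subspace_def)
  also have "dim ?L = card ((\<lambda>i. axis i (1::real)) ` (- J) :: (real ^ 'n) set)"
    by (intro dim_substandard) (auto simp: Basis_vec_def)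
  also have "\<dots> = card (- J)"
    by (intro card_image) (auto simp: inj_on_def axis_eq_axis)
  also have "int (card (- J)) = int CARD('n) - int (card J)"
    by (simp add: Compl_eq_Diff_UNIV card_Diff_subset of_nat_diff card_mono)
  finally show ?thesis .
qed

text \<open>Each injective choice \<sigma> of touched facets gives one affine space of corners. The
  finitely many projections of these cover the set, so a convex subset lies in a single one.\<close>

lemma polyhedral_dim_common_nearest_le:
  fixes S :: "(real ^ 'n) set"
  assumes S: "S \<subseteq> sum_zero_space" and gp: "general_position S"
    and T: "finite T" "T \<subseteq> S" "T \<noteq> {}" "card T \<le> CARD('n)"
  shows "polyhedral_dim {x \<in> sum_zero_space. T \<subseteq> nearest_sites S x} \<le> int CARD('n) - int (card T)"
proof (rule polyhedral_dim_le)
  let ?X = "{x \<in> sum_zero_space. T \<subseteq> nearest_sites S x}"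
  let ?B = "\<lambda>\<sigma>. {w :: real ^ 'n. \<forall>a\<in>T. w $ \<sigma> a = a $ \<sigma> a}"
  \<comment> \<open>Extensional functions on \<open>T\<close>, so that there are only finitely
    many.\<close>
  define \<Sigma> :: "(real ^ 'n \<Rightarrow> 'n) set" where "\<Sigma> = {\<sigma> \<in> T \<rightarrow>\<^sub>E UNIV. inj_on \<sigma> T}"
  have fin: "finite \<Sigma>" using finite_PiE[OF T(1), of "\<lambda>_. UNIV :: 'n set"] unfolding \<Sigma>_def by auto
  \<comment> \<open>Injectivity lets the fixed value be indexed by the facet instead of the
    site.\<close>
  have B: "?B \<sigma> = {w. \<forall>j\<in>\<sigma> ` T. w $ j = (\<chi> j. the_inv_into T \<sigma> j $ j) $ j}"
    if "\<sigma> \<in> \<Sigma>" for \<sigma>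
    using that the_inv_into_f_f[of \<sigma> T] unfolding \<Sigma>_def by auto
  fix P :: "(real ^ 'n) set" assume P: "polyhedron P" "P \<subseteq> ?X"
  show "aff_dim P \<le> int CARD('n) - int (card T)"
  proof (cases "P = {}")
    case True
    \<comment> \<open>The empty polyhedron has dimension -1, so the bound has to be at least
      -1.\<close>
    then show ?thesis using T(4) by simp
  next
    case False
    have "P \<subseteq> (\<Union>\<sigma>\<in>\<Sigma>. proj ` ?B \<sigma>)"
    proof
      fix x assume "x \<in> P"
      then have x: "x \<in> sum_zero_space" "T \<subseteq> nearest_sites S x" using P by auto
      then obtain w where w: "corner S (nearest_sites S x) w" "proj w = x"
        using ex_corner[OF S x(1)] T(3) by blast
      then obtain \<sigma> where \<sigma>: "inj_on \<sigma> T" "\<forall>a\<in>T. w $ \<sigma> a = a $ \<sigma> a"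
        using corner_contacts[OF gp T(2), of w] x(2) unfolding corner_def by blast
      then have "restrict \<sigma> T \<in> \<Sigma>" "w \<in> ?B (restrict \<sigma> T)"
        unfolding \<Sigma>_def by auto
      then show "x \<in> (\<Union>\<sigma>\<in>\<Sigma>. proj ` ?B \<sigma>)" using w(2) by blast
    qed
    moreover have "affine (proj ` ?B \<sigma>)" if "\<sigma> \<in> \<Sigma>" for \<sigma>
      unfolding B[OF that] by (intro affine_proj_image affine_fixed_coordinates)
    ultimately have "\<exists>A\<in>(\<lambda>\<sigma>. proj ` ?B \<sigma>) ` \<Sigma>. P \<subseteq> A"
      by (intro convex_subset_Union_affine finite_imageI fin polyhedron_imp_convex P(1) False) blast+
    then obtain \<sigma> where \<sigma>: "\<sigma> \<in> \<Sigma>" "P \<subseteq> proj ` ?B \<sigma>" by (elim bexE imageE) simp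
    have inj: "inj_on \<sigma> T" using \<sigma> unfolding \<Sigma>_def by auto
    have "aff_dim (?B \<sigma>) = int CARD('n) - int (card T)"
      unfolding B[OF \<sigma>(1)] aff_dim_fixed_coordinates card_image[OF inj] ..
    moreover have "aff_dim P \<le> aff_dim (proj ` ?B \<sigma>)" using \<sigma>(2) by (rule aff_dim_subset)
    moreover have "aff_dim (proj ` ?B \<sigma>) \<le> aff_dim (?B \<sigma>)"
      by (rule aff_dim_linear_image_le[OF linear_proj])
    ultimately show ?thesis by linarith
  qed
qed

section \<open>The lower bound on the dimension\<close>

text \<open>Fixing one coordinate selects at most one point on each fibre of \<open>proj\<close>;
  the affine map \<open>\<lambda>x. x - vec (x $ j) + vec r\<close> recovers it.\<close>

lemma aff_dim_proj_image_ge: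
  fixes B :: "(real ^ 'n) set"
  assumes "\<And>w. w \<in> B \<Longrightarrow> w $ j = r"
  shows "aff_dim B \<le> aff_dim (proj ` B)"
proof -
  let ?h = "\<lambda>x :: real ^ 'n. x - vec (x $ j)"
  have lin: "linear ?h" by (rule linearI) (simp_all add: vec_eq_iff algebra_simps)
  have "w = vec r + ?h (proj w)" if "w \<in> B" for w
    using assms[OF that] by (simp add: proj_def vec_eq_iff)
  then have "B = (+) (vec r) ` ?h ` proj ` B"
    unfolding image_image by (metis (no_types, lifting) image_cong image_ident)
  then have "aff_dim B = aff_dim (?h ` proj ` B)" by (metis aff_dim_translation_eq)
  also have "\<dots> \<le> aff_dim (proj ` B)" by (rule aff_dim_linear_image_le[OF lin])
  finally show ?thesis .
qed

text \<open>Fix the touched coordinates of \<open>w\<close> and let the others decrease by at most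
  \<open>e\<close>. All these points are corners for \<open>T\<close>, and their projections form a
  polytope in the V-cell.\<close>

lemma polyhedral_dim_V_set_ge:
  fixes S :: "(real ^ 'n) set"
  assumes S: "S \<subseteq> sum_zero_space" and disc: "discrete_sites S" and gp: "general_position S"
    and c: "corner S T w" and ne: "T \<noteq> {}"
  shows "int CARD('n) - int (card T) \<le> polyhedral_dim (V_set S T)"
proof -
  have T: "T \<subseteq> S" and t0: "\<And>a. a \<in> T \<Longrightarrow> tmax w a = 0"
    and out: "\<And>b. b \<in> S - T \<Longrightarrow> \<exists>i. 0 < w $ i - b $ i"
    using c unfolding corner_def less_tmax_iff by auto
  obtain \<sigma> where \<sigma>: "inj_on \<sigma> T" "\<forall>a\<in>T. w $ \<sigma> a = a $ \<sigma> a"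
    using corner_contacts[OF gp T t0] by blast
  define J where "J = \<sigma> ` T"
  \<comment> \<open>Lowering coordinates by at most 1 can bring only these sites into the orthant.
    They are finitely many, so a uniform gap \<open>g\<close> exists.\<close>
  define F where "F = {b \<in> S. \<forall>i. (w - vec 1) $ i \<le> b $ i}"
  have "finite ((\<lambda>(b, i). w $ i - b $ i) ` (F \<times> UNIV))"
    unfolding F_def by (intro finite_imageI finite_cartesian_product finite_sites_bounded_below S disc) simp
  from finite_positive_gap[OF this] obtain g where g: "g > 0"
    "\<And>b i. b \<in> F \<Longrightarrow> b $ i < w $ i \<Longrightarrow> b $ i < w $ i - g" by force
  define e where "e = min g 1"
  have e: "e > 0" "e \<le> g" "e \<le> 1" using g unfolding e_def by auto
  \<comment> \<open>The slack on \<open>J\<close> only serves to let the open box meet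
    \<open>A\<close>, which fixes these coordinates.\<close>
  define u where "u = (\<chi> i. if i \<in> J then w $ i + 1 else w $ i)"
  define A where "A = {v. \<forall>j\<in>J. v $ j = w $ j}"
  define B where "B = A \<inter> cbox (w - vec e) u"
  have affA: "affine A" unfolding A_def by (rule affine_fixed_coordinates)
  have corner: "corner S T v" if v: "v \<in> B" for v
  proof -
    have eq: "v $ j = w $ j" if "j \<in> J" for j using v that unfolding B_def A_def by auto
    have lo: "w $ i - e \<le> v $ i" for i using v unfolding B_def by (simp add: mem_box_cart)
    have hi: "v $ i \<le> w $ i" for i
    proof (cases "i \<in> J")
      case False
      have "v $ i \<le> u $ i" using v unfolding B_def by (simp add: mem_box_cart)
      then show ?thesis using False unfolding u_def by simp
    qed (simp add: eq)
    show ?thesis unfolding corner_def tmax_eq_0_iff less_tmax_iff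
    proof (intro conjI ballI allI)
      show "T \<subseteq> S" by (rule T)
    next
      fix a i assume "a \<in> T"
      then show "v $ i \<le> a $ i" using t0 hi unfolding tmax_eq_0_iff by (meson order_trans)
    next
      fix a assume "a \<in> T"
      then show "\<exists>i. v $ i = a $ i" using \<sigma> eq[of "\<sigma> a"] unfolding J_def by auto
    next
      fix b assume b: "b \<in> S - T"
      show "\<exists>i. 0 < v $ i - b $ i"
      proof (cases "b \<in> F")
        case True
        obtain i where "0 < w $ i - b $ i" using out[OF b] by blast
        then have "0 < v $ i - b $ i" using g(2)[OF True, of i] lo[of i] e by linarith
        then show ?thesis by blast
      next
        case False
        then obtain i where "b $ i < w $ i - 1" using b unfolding F_def by (auto simp: not_le)
        then have "0 < v $ i - b $ i" using lo[of i] e by linarith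
        then show ?thesis by blast
      qed
    qed
  qed
  have "(\<chi> i. if i \<in> J then w $ i else w $ i - e / 2) \<in> A \<inter> box (w - vec e) u"
    using e unfolding A_def u_def by (auto simp: mem_box_cart)
  then have "aff_dim (A \<inter> box (w - vec e) u) = aff_dim A"
    by (intro aff_dim_convex_Int_open affine_imp_convex affA open_box) auto
  moreover have "aff_dim (A \<inter> box (w - vec e) u) \<le> aff_dim B"
    unfolding B_def using box_subset_cbox by (intro aff_dim_subset) blast
  moreover have "aff_dim A = int CARD('n) - int (card T)"
    using aff_dim_fixed_coordinates[of J w] card_image[OF \<sigma>(1)] unfolding A_def J_def by simp
  moreover have "aff_dim B \<le> aff_dim (proj ` B)"
  proof -
    obtain j where "j \<in> J" using ne unfolding J_def by auto
    then show ?thesis using aff_dim_proj_image_ge[of B j "w $ j"] unfolding B_def A_def by auto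
  qed
  moreover have "aff_dim (proj ` B) \<le> polyhedral_dim (V_set S T)"
  proof (rule polyhedral_dim_ge)
    \<comment> \<open>Boundedness makes \<open>B\<close> a polytope, and linear images of polytopes
      are polytopes.\<close>
    have "polyhedron B"
      unfolding B_def by (intro polyhedron_Int affine_imp_polyhedron affA polyhedron_interval)
    moreover have "bounded B" unfolding B_def by (simp add: bounded_Int)
    ultimately have "polytope B" by (simp add: polytope_eq_bounded_polyhedron)
    then show "polyhedron (proj ` B)"
      by (intro polytope_imp_polyhedron polytope_linear_image linear_proj)
    show "proj ` B \<subseteq> V_set S T"
      using nearest_sites_proj_corner[OF S corner ne] proj_in_sum_zero_space
      unfolding V_set_def by auto
  qed
  ultimately show ?thesis by linarith
qed

lemma polyhedral_dim_mono: "X \<subseteq> Y \<Longrightarrow> polyhedral_dim X \<le> polyhedral_dim Y"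
  by (rule polyhedral_dim_le) (meson order_trans polyhedral_dim_ge)

theorem theorem6p3:
  fixes S :: "(real ^ 'n) set"
  assumes "CARD('n) \<ge> 2"
    and "S \<noteq> {}" and "S \<subseteq> sum_zero_space"
    and "discrete_sites S"
    and "general_position S"
  shows "voronoi_cells S = closure ` V_cells S \<and>
    (\<forall>T. T \<subseteq> S \<and> V_set S T \<noteq> {} \<longrightarrow>
       finite T \<and>
       polyhedral_dim (V_set S T) = int CARD('n) - int (card T) \<and>
       polyhedral_dim (closure (V_set S T)) = int CARD('n) - int (card T))"
proof (intro conjI allI impI)
  note closure_eq = closure_V_set[OF assms(3,5)]
  have nonempty: "T \<noteq> {}" if "V_set S T \<noteq> {}" for T
    using that nearest_sites_nonempty[OF assms(3,4,2)] unfolding V_set_def by blast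
  show "voronoi_cells S = closure ` V_cells S"
  proof
    show "voronoi_cells S \<subseteq> closure ` V_cells S"
    proof
      fix C assume "C \<in> voronoi_cells S"
      then obtain A where A: "C \<noteq> {}" "A \<noteq> {}" "A \<subseteq> S" "C = (\<Inter>a\<in>A. voronoi_region S a)"
        unfolding voronoi_cells_def by blast
      then have C: "C = closure (V_set S A)" using Inter_voronoi_regions closure_eq by metis
      \<comment> \<open>The closure of an empty V-cell would be empty, unlike
        \<open>C\<close>.\<close>
      then have "V_set S A \<noteq> {}" using A(1) by auto
      then show "C \<in> closure ` V_cells S" using C A(3) unfolding V_cells_def by blast
    qed
    show "closure ` V_cells S \<subseteq> voronoi_cells S"
    proof
      fix C assume "C \<in> closure ` V_cells S"
      then obtain T where T: "T \<subseteq> S" "V_set S T \<noteq> {}" "C = closure (V_set S T)"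
        unfolding V_cells_def by blast
      then have "C = (\<Inter>a\<in>T. voronoi_region S a)"
        using Inter_voronoi_regions closure_eq nonempty by metis
      moreover have "C \<noteq> {}" using T by simp
      ultimately show "C \<in> voronoi_cells S"
        using T(1) nonempty[OF T(2)] unfolding voronoi_cells_def by blast
    qed
  qed
  fix T assume T: "T \<subseteq> S \<and> V_set S T \<noteq> {}"
  have ne: "T \<noteq> {}" using nonempty T by blast
  obtain x where "x \<in> sum_zero_space" "nearest_sites S x = T" using T unfolding V_set_def by blast
  then obtain w where w: "corner S T w" using ex_corner[OF assms(3)] ne by blast
  show fin: "finite T" using corner_finite[OF assms(5) w] .
  obtain \<sigma> :: "real ^ 'n \<Rightarrow> 'n" where "inj_on \<sigma> T"
    using corner_contacts[OF assms(5), of T w] w unfolding corner_def by blast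
  then have "card T \<le> CARD('n)" by (intro card_inj_on_le[of \<sigma>]) auto
  \<comment> \<open>Both dimensions are squeezed: the upper bound holds for the closure, the lower
    bound for the cell, and the dimension is monotone.\<close>
  then have "polyhedral_dim (closure (V_set S T)) \<le> int CARD('n) - int (card T)"
    using polyhedral_dim_common_nearest_le[OF assms(3,5) fin _ ne] closure_eq[OF _ ne] T by metis
  moreover have "int CARD('n) - int (card T) \<le> polyhedral_dim (V_set S T)"
    by (rule polyhedral_dim_V_set_ge[OF assms(3,4,5) w ne])
  moreover have "polyhedral_dim (V_set S T) \<le> polyhedral_dim (closure (V_set S T))"
    by (intro polyhedral_dim_mono closure_subset)
  ultimately show "polyhedral_dim (V_set S T) = int CARD('n) - int (card T)"
    "polyhedral_dim (closure (V_set S T)) = int CARD('n) - int (card T)" by linarith+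
qed

end
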